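(* Let $(G,+)$ be a finite group (not necessarily abelian) with $|G|>1$, and let $\mathbf{B}$ be a $(v,k,\lambda)$-short difference family in $G$. Then the development $\mathrm{dev}\,\mathbf{B}=\{B+g \mid B\in\mathbf{B},\ g\in G\}$ is a $(v,k,\lambda)$-design on the point set $G$.
   Context: Groups are written additively but need not be abelian. For a finite group $(G,+)$ and $B\subseteq G$, $g\in G$, write $B+g=\{b+g\mid b\in B\}$ and $G_B=\{g\in G\mid B+g=B\}$. Designs: let $V$ be a set of size $v>1$ and let $k,\lambda$ be positive integers. A $(v,k,\lambda)$-design on $V$ is a set $\mathbf{B}$ of subsets of $V$ (so no repeated blocks) such that (i) $|B|=k$ for all $B\in\mathbf{B}$; (ii) $|\{B\in\mathbf{B}\mid u,w\in B\}|=\lambda$ for all $u,w\in V$ with $u\neq w$. Equivalence: for a set $\mathbf{B}$ of subsets of $G$ and $B,C\in\mathbf{B}$, put $B\sim C$ iff there is $g\in G$ with $B=C+g$. This is an equivalence relation on $\mathbf{B}$, and $B/\!\sim$ denotes the equivalence class of $B$ in $\mathbf{B}$. Short difference family (sdf): let $\mathbf{B}$ be a set of subsets of the finite group $(G,+)$ with $v=|G|>1$, and let $k,\mu,\nu,\lambda'$ be positive integers such that (1) $|B|=k$ for all $B\in\mathbf{B}$; (2) $|G_B|=\mu$ for all $B\in\mathbf{B}$; (3) $|B/\!\sim|=\nu$ for all $B\in\mathbf{B}$; (4) $|\{(B,a,b)\mid B\in\mathbf{B},\ a,b\in B,\ a-b=d\}|=\lambda'$ for all $d\in G$, $d\neq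 0$. Then $\mathbf{B}$ is called a $(v,k,\frac{\lambda'}{\mu\nu})$-short difference family in $G$. *)

theory Defs
  imports Complex_Main
begin

text \<open>
  A finite group, written additively but not necessarily abelian, is a type of class
  \<open>{group_add, finite}\<close>; the group G is then the whole type. In this class
  \<open>a - b\<close> is \<open>a + (- b)\<close>, and no commutativity of \<open>+\<close> is assumed.
\<close>

definition rtranslate :: "'a::group_add set \<Rightarrow> 'a \<Rightarrow> 'a set" where
  "rtranslate B g = {b + g | b. b \<in> B}"

definition stabilizer :: "'a::group_add set \<Rightarrow> 'a set" where
  "stabilizer B = {g. rtranslate B g = B}"

definition translate_rel :: "'a::group_add set set \<Rightarrow> ('a set \<times> 'a set) set" where
  "translate_rel \<B> = {(B, C). B \<in> \<B> \<and> C \<in> \<B> \<and> (\<exists>g. B = rtranslate C g)}"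

definition dev :: "'a::group_add set set \<Rightarrow> 'a set set" where
  "dev \<B> = {rtranslate B g | B g. B \<in> \<B>}"

definition is_design :: "'p set \<Rightarrow> nat \<Rightarrow> nat \<Rightarrow> nat \<Rightarrow> 'p set set \<Rightarrow> bool" where
  "is_design V v k l \<B> \<longleftrightarrow>
     card V = v \<and> v > 1 \<and> k > 0 \<and> l > 0 \<and>
     \<B> \<subseteq> Pow V \<and>
     (\<forall>B\<in>\<B>. card B = k) \<and>
     (\<forall>u\<in>V. \<forall>w\<in>V. u \<noteq> w \<longrightarrow> card {B \<in> \<B>. u \<in> B \<and> w \<in> B} = l)"

text \<open>
  The third parameter is the quotient \<open>l' / (\<mu> * \<nu>)\<close>, which the definition does not
  require to be an integer; hence it is rational. The relation image in the third
  condition is the equivalence class of \<open>B\<close> in \<open>\<B>\<close>.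
\<close>

definition is_sdf :: "nat \<Rightarrow> nat \<Rightarrow> rat \<Rightarrow> 'a::{group_add, finite} set set \<Rightarrow> bool" where
  "is_sdf v k l \<B> \<longleftrightarrow>
     card (UNIV :: 'a set) = v \<and> v > 1 \<and> k > 0 \<and>
     (\<exists>\<mu> \<nu> l' :: nat. \<mu> > 0 \<and> \<nu> > 0 \<and> l' > 0 \<and>
        (\<forall>B\<in>\<B>. card B = k) \<and>
        (\<forall>B\<in>\<B>. card (stabilizer B) = \<mu>) \<and>
        (\<forall>B\<in>\<B>. card (translate_rel \<B> `` {B}) = \<nu>) \<and>
        (\<forall>d::'a. d \<noteq> 0 \<longrightarrow>
           card {(B, a, b). B \<in> \<B> \<and> a \<in> B \<and> b \<in> B \<and> a - b = d} = l') \<and>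
        l = of_nat l' / (of_nat \<mu> * of_nat \<nu>))"

end

theory Submission
  imports Defs
begin

text \<open>
  Double counting. For distinct points \<open>u\<close>, \<open>w\<close>, the pairs \<open>(B, g)\<close> with \<open>u, w \<in> B + g\<close>
  correspond to the representations \<open>a - b = u - w\<close> with \<open>a, b \<in> B\<close>, through
  \<open>a = u - g\<close>, \<open>b = w - g\<close>; so there are \<open>l'\<close> of them. On the other hand every block of the
  development has exactly \<open>\<mu> * \<nu>\<close> representations \<open>B + g\<close>: \<open>B\<close> ranges over one equivalence
  class, and for given \<open>B\<close> the admissible \<open>g\<close> form a right coset of the stabilizer of \<open>B\<close>.
\<close>

lemma rtranslate_image: "rtranslate B g = (\<lambda>b. b + g) ` B"
  by (auto simp: rtranslate_def)

lemma mem_rtranslate_iff: "x \<in> rtranslate B g \<longleftrightarrow> x - g \<in> B"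
  by (force simp: rtranslate_image)

lemma card_rtranslate: "card (rtranslate B g) = card B"
  unfolding rtranslate_image by (rule card_image) (simp add: inj_on_def)

lemma rtranslate_rtranslate: "rtranslate (rtranslate B g) h = rtranslate B (g + h)"
  by (simp add: rtranslate_image image_image add.assoc)

lemma rtranslate_eq_iff: "rtranslate B g = C \<longleftrightarrow> B = rtranslate C (- g)"
proof -
  have "rtranslate X 0 = X" for X :: "'a set"
    by (simp add: rtranslate_image)
  then show ?thesis
    by (metis add.right_inverse add.left_inverse rtranslate_rtranslate)
qed

text \<open>Adding \<open>- h\<close> on the right turns \<open>B + g = B + h\<close> into
  \<open>B + (g - h) = B\<close>, so \<open>g\<close> is an admissible translation exactly when
  \<open>g - h\<close> fixes \<open>B\<close>.\<close>

lemma translators_eq_coset: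
  assumes "rtranslate B h = C"
  shows "{g. rtranslate B g = C} = (\<lambda>s. s + h) ` stabilizer B"
proof -
  have "rtranslate B g = C \<longleftrightarrow> g - h \<in> stabilizer B" for g
    using assms rtranslate_eq_iff[of "rtranslate B g" "- h" B]
    by (auto simp: stabilizer_def rtranslate_rtranslate)
  then show ?thesis
    by (force simp: image_iff)
qed

lemma card_translators:
  assumes "rtranslate B h = C"
  shows "card {g. rtranslate B g = C} = card (stabilizer B)"
  unfolding translators_eq_coset[OF assms] by (rule card_image) (simp add: inj_on_def)

text \<open>\<open>B + g = B0 + h\<close> is the same as \<open>B0 = B + (g - h)\<close>. So the
  class of \<open>B0\<close> can be read off from any translate of \<open>B0\<close>, even one
  outside \<open>\<B>\<close>; hence the free \<open>h\<close>.\<close>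

lemma translate_class_eq:
  assumes "B0 \<in> \<B>"
  shows "translate_rel \<B> `` {B0} = {B \<in> \<B>. \<exists>g. rtranslate B g = rtranslate B0 h}"
proof -
  have "(\<exists>g. B0 = rtranslate B g) \<longleftrightarrow> (\<exists>g. rtranslate B g = rtranslate B0 h)" for B
    by (metis rtranslate_eq_iff rtranslate_rtranslate)
  then show ?thesis
    using assms by (auto simp: translate_rel_def)
qed

lemma card_representations:
  fixes \<B> :: "'a::{group_add, finite} set set"
  assumes stab: "\<forall>B\<in>\<B>. card (stabilizer B) = \<mu>"
    and cls: "\<forall>B\<in>\<B>. card (translate_rel \<B> `` {B}) = \<nu>"
    and "C \<in> dev \<B>"
  shows "card {(B, g). B \<in> \<B> \<and> rtranslate B g = C} = \<mu> * \<nu>"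
proof -
  obtain B0 h where B0: "B0 \<in> \<B>" and C: "C = rtranslate B0 h"
    using \<open>C \<in> dev \<B>\<close> by (auto simp: dev_def)
  let ?K = "translate_rel \<B> `` {B0}"
  have K: "?K = {B \<in> \<B>. \<exists>g. rtranslate B g = C}"
    unfolding C by (rule translate_class_eq[OF B0])
  \<comment> \<open>The pairs are grouped by first component: \<open>\<nu>\<close> sets
    \<open>B\<close>, each with \<open>\<mu>\<close> translations.\<close>
  have "{(B, g). B \<in> \<B> \<and> rtranslate B g = C} = (SIGMA B:?K. {g. rtranslate B g = C})"
    unfolding K by auto
  then have "card {(B, g). B \<in> \<B> \<and> rtranslate B g = C}
      = (\<Sum>B\<in>?K. card {g. rtranslate B g = C})"
    by simp
  also have "\<dots> = (\<Sum>B\<in>?K. \<mu>)"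
  proof (rule sum.cong[OF refl])
    fix B assume "B \<in> ?K"
    then show "card {g. rtranslate B g = C} = \<mu>"
      unfolding K using card_translators stab by fastforce
  qed
  also have "\<dots> = \<mu> * \<nu>"
    using cls B0 by simp
  finally show ?thesis .
qed

text \<open>As \<open>g\<close> acts on the right, it cancels in \<open>(u - g) - (w - g)\<close>
  without commutativity.\<close>

lemma card_pairs_eq_card_differences:
  fixes \<B> :: "'a::{group_add, finite} set set"
  shows "card {(B, g). B \<in> \<B> \<and> u \<in> rtranslate B g \<and> w \<in> rtranslate B g}
    = card {(B, a, b). B \<in> \<B> \<and> a \<in> B \<and> b \<in> B \<and> a - b = u - w}"
proof (rule bij_betw_same_card)
  \<comment> \<open>With \<open>g = - a + u\<close>, the left side is \<open>w - g\<close>: the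
    translation recovered from \<open>a\<close> alone also yields \<open>b\<close>.\<close>
  have inverse: "w + (- u + a) = b" if "a + - b = u + - w" for a b :: 'a
  proof -
    have "a = u + - w + b"
      using that by (metis add.assoc add.left_inverse add.right_neutral)
    then show ?thesis
      by (simp add: add.assoc del: add_uminus_conv_diff)
  qed
  show "bij_betw (\<lambda>(B, g). (B, u - g, w - g))
      {(B, g). B \<in> \<B> \<and> u \<in> rtranslate B g \<and> w \<in> rtranslate B g}
      {(B, a, b). B \<in> \<B> \<and> a \<in> B \<and> b \<in> B \<and> a - b = u - w}"
    \<comment> \<open>\<open>- a + u\<close> is the solution \<open>g\<close> of
      \<open>a = u - g\<close>.\<close>
    by (rule bij_betw_byWitness[where f' = "\<lambda>(B, a, b). (B, - a + u)"])
       (auto simp: mem_rtranslate_iff inverse diff_conv_add_uminus minus_add add.assoc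
         simp del: add_uminus_conv_diff)
qed

text \<open>The pairs are sorted by the block \<open>C = B + g\<close>; the fibres are disjoint and
  all of size \<open>\<mu> * \<nu>\<close>.\<close>

lemma card_pairs_eq_mult:
  fixes \<B> :: "'a::{group_add, finite} set set"
  assumes "\<forall>B\<in>\<B>. card (stabilizer B) = \<mu>"
    and "\<forall>B\<in>\<B>. card (translate_rel \<B> `` {B}) = \<nu>"
  shows "card {(B, g). B \<in> \<B> \<and> u \<in> rtranslate B g \<and> w \<in> rtranslate B g}
    = card {C \<in> dev \<B>. u \<in> C \<and> w \<in> C} * (\<mu> * \<nu>)"
proof -
  let ?D = "{C \<in> dev \<B>. u \<in> C \<and> w \<in> C}"
  have "{(B, g). B \<in> \<B> \<and> u \<in> rtranslate B g \<and> w \<in> rtranslate B g}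
      = (\<Union>C\<in>?D. {(B, g). B \<in> \<B> \<and> rtranslate B g = C})"
    by (auto simp: dev_def)
  also have "card \<dots> = (\<Sum>C\<in>?D. card {(B, g). B \<in> \<B> \<and> rtranslate B g = C})"
    by (rule card_UN_disjoint) auto
  also have "\<dots> = (\<Sum>C\<in>?D. \<mu> * \<nu>)"
    using card_representations[OF assms] by (intro sum.cong) auto
  finally show ?thesis
    by simp
qed

theorem proposition2p2:
  fixes \<B> :: "'a::{group_add, finite} set set" and v k :: nat and l :: rat
  assumes "card (UNIV :: 'a set) > 1"
    and "is_sdf v k l \<B>"
  shows "\<exists>m::nat. l = of_nat m \<and> is_design (UNIV :: 'a set) v k m (dev \<B>)"
proof -
  obtain \<mu> \<nu> l' :: nat where pos: "\<mu> > 0" "\<nu> > 0" "l' > 0"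
    and size: "\<forall>B\<in>\<B>. card B = k"
    and stab: "\<forall>B\<in>\<B>. card (stabilizer B) = \<mu>"
    and cls: "\<forall>B\<in>\<B>. card (translate_rel \<B> `` {B}) = \<nu>"
    and diffs: "\<And>d::'a. d \<noteq> 0 \<Longrightarrow>
      card {(B, a, b). B \<in> \<B> \<and> a \<in> B \<and> b \<in> B \<and> a - b = d} = l'"
    and l: "l = of_nat l' / (of_nat \<mu> * of_nat \<nu>)"
    and vk: "card (UNIV :: 'a set) = v" "v > 1" "k > 0"
    using assms(2) unfolding is_sdf_def by blast
  have count: "card {C \<in> dev \<B>. u \<in> C \<and> w \<in> C} * (\<mu> * \<nu>) = l'" if "u \<noteq> w" for u w :: 'a
    using card_pairs_eq_mult[OF stab cls, of u w] card_pairs_eq_card_differences[of \<B> u w]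
      diffs[of "u - w"] that by simp
  \<comment> \<open>One concrete pair of distinct points, \<open>x\<close> and \<open>0\<close>,
    shows that \<open>l\<close> is an integer: it is the number \<open>m\<close> of blocks through
    them.\<close>
  obtain x :: 'a where "x \<noteq> 0"
    using assms(1) card_mono[of "{0 :: 'a}" UNIV] by fastforce
  define m where "m = card {C \<in> dev \<B>. x \<in> C \<and> 0 \<in> C}"
  have m: "m * (\<mu> * \<nu>) = l'"
    unfolding m_def using count \<open>x \<noteq> 0\<close> by blast
  have "l = of_nat m"
    using pos unfolding l m[symmetric] by simp
  moreover have "m > 0"
    using m pos by (cases m) auto
  moreover have "card {C \<in> dev \<B>. u \<in> C \<and> w \<in> C} = m" if "u \<noteq> w" for u w :: 'a
    \<comment> \<open>Cancelling \<open>\<mu> * \<nu> > 0\<close> carries the value \<open>m\<close>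
      over to every other pair.\<close>
    using count[OF that] m pos by (metis mult_cancel2 mult_pos_pos not_less_zero)
  moreover have "\<forall>C\<in>dev \<B>. card C = k"
    using size by (auto simp: dev_def card_rtranslate)
  ultimately show ?thesis
    using vk by (auto simp: is_design_def)
qed

end
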